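(* For $v=1,2$ let $\mathcal{M}^v=\langle G^v,C^v,A^v,B^v\rangle$ be a constrained matrix zonotope with $s_v$ generators, where $G^v\in\mathbb{R}^{n\times ps_v}$, $C^v\in\mathbb{R}^{n\times p}$, $A^v\in\mathbb{R}^{k_v\times q_vs_v}$ and $B^v\in\mathbb{R}^{k_v\times q_v}$. Let $b=\max(p,q_1,q_2)$ and, for $v=1,2$ and $i=1,\dots,s_v$, put $$\bar A^v_{:,i}=[A^v_{:,i}\ \ \mathbf{0}_{k_v\times(b-q_v)}],\quad \bar B^v=[B^v\ \ \mathbf{0}_{k_v\times(b-q_v)}]\in\mathbb{R}^{k_v\times b},$$ $$\bar G^v_{:,i}=[G^v_{:,i}\ \ \mathbf{0}_{n\times(b-p)}],\quad \bar C^v=[C^v\ \ \mathbf{0}_{n\times(b-p)}]\in\mathbb{R}^{n\times b},$$ $\bar A^v=[\bar A^v_{:,1}\ \cdots\ \bar A^v_{:,s_v}]$ and $\bar G^v=[\bar G^v_{:,1}\ \cdots\ \bar G^v_{:,s_v}]$. Then $$\mathcal{M}^1\cap\mathcal{M}^2=\left\langle[G^1\ \ \mathbf{0}_{n\times ps_2}],\ C^1,\ \begin{bmatrix}\bar A^1&\mathbf{0}_{k_1\times bs_2}\\ \mathbf{0}_{k_2\times bs_1}&\bar A^2\\ \bar G^1&-\bar G^2\end{bmatrix},\ \begin{bmatrix}\bar B^1\\ \bar B^2\\ \bar C^2-\bar C^1\end{bmatrix}\right\rangle.$$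
   Context: A constrained matrix zonotope of dimension $(n,m)$ with $s$ generators is $$\langle G,C,\bar A,\bar B\rangle=\Big\{C+\sum_{i=1}^sG_{:,i}\zeta_i:\ \zeta\in\mathbb{R}^s,\ \|\zeta\|\le1,\ \sum_{i=1}^s\bar A_{:,i}\zeta_i=\bar B\Big\},$$ where $\|\cdot\|$ is the infinity norm, $C\in\mathbb{R}^{n\times m}$, $G=[G_{:,1},\dots,G_{:,s}]$ with blocks $G_{:,i}\in\mathbb{R}^{n\times m}$, $\bar A=[\bar A_{:,1},\dots,\bar A_{:,s}]$ with blocks $\bar A_{:,i}\in\mathbb{R}^{n_c\times m_c}$, and $\bar B\in\mathbb{R}^{n_c\times m_c}$. *)

theory Defs
  imports Complex_Main "Jordan_Normal_Form.Matrix"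
begin

text \<open>Matrices with block structure are indexed from 0: an \<open>n \<times> (m * s)\<close> matrix is the row
  of its \<open>s\<close> blocks of width \<open>m\<close>, and column \<open>i * m + c\<close> is column \<open>c\<close> of block \<open>i\<close>.\<close>

definition col_block :: "nat \<Rightarrow> 'a mat \<Rightarrow> nat \<Rightarrow> 'a mat" where
  "col_block m M i = mat (dim_row M) m (\<lambda>(r, c). M $$ (r, i * m + c))"

definition row_of_blocks :: "nat \<Rightarrow> nat \<Rightarrow> nat \<Rightarrow> (nat \<Rightarrow> 'a mat) \<Rightarrow> 'a mat" where
  "row_of_blocks n m s F = mat n (m * s) (\<lambda>(r, c). F (c div m) $$ (r, c mod m))"

text \<open>The horizontal counterpart of \<^const>\<open>append_rows\<close>.\<close>

definition append_cols :: "'a :: zero mat \<Rightarrow> 'a mat \<Rightarrow> 'a mat" (infixr \<open>@\<^sub>c\<close> 66) where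
  "A @\<^sub>c B = four_block_mat A B (0\<^sub>m 0 (dim_col A)) (0\<^sub>m 0 (dim_col B))"

text \<open>The 0 is only relevant for the empty vector, whose norm is 0.\<close>

definition linf_norm :: "real vec \<Rightarrow> real" where
  "linf_norm v = Max (insert 0 ((\<lambda>i. \<bar>v $ i\<bar>) ` {..<dim_vec v}))"

definition block_comb :: "nat \<Rightarrow> nat \<Rightarrow> nat \<Rightarrow> real mat \<Rightarrow> real vec \<Rightarrow> real mat" where
  "block_comb n m s M \<zeta> =
     finsum (module_mat TYPE(real) n m) (\<lambda>i. (\<zeta> $ i) \<cdot>\<^sub>m col_block m M i) {..<s}"

text \<open>The number of generators \<open>s\<close> is explicit; the widths of the blocks of \<open>G\<close> and \<open>A\<close> are
  those of \<open>C\<close> and \<open>B\<close>. Intended for \<open>G\<close>, \<open>A\<close> with \<open>s\<close> such blocks and as many rows as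
  \<open>C\<close>, \<open>B\<close>, respectively.\<close>

definition constrained_matrix_zonotope ::
  "nat \<Rightarrow> real mat \<Rightarrow> real mat \<Rightarrow> real mat \<Rightarrow> real mat \<Rightarrow> real mat set" where
  "constrained_matrix_zonotope s G C A B =
     {C + block_comb (dim_row C) (dim_col C) s G \<zeta> | \<zeta>.
        \<zeta> \<in> carrier_vec s \<and> linf_norm \<zeta> \<le> 1 \<and>
        block_comb (dim_row B) (dim_col B) s A \<zeta> = B}"

end

(* A parameter of the intersection is the concatenation of a parameter z of the first zonotope and
   a parameter w of the second. The stacked linear constraint splits into the two original
   constraints and G2 w - G1 z = C1 - C2, which says that both parameters describe the same matrix;
   the zero columns only equalise the widths of the three constraints. *)

theory Submission
  imports Defs
begin

section \<open>Matrices stacked vertically or horizontally\<close>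

lemma index_append_rows:
  assumes "A \<in> carrier_mat n1 m" and "B \<in> carrier_mat n2 m" and "r < n1 + n2" and "c < m"
  shows "(A @\<^sub>r B) $$ (r, c) = (if r < n1 then A $$ (r, c) else B $$ (r - n1, c))"
  using assms by (simp add: append_rows_def)

text \<open>Both sides are cut at the same row \<open>n1\<close>, so comparing entries above and
  below the cut separates the parts. This breaks the stacked constraint into its three block
  rows.\<close>

lemma append_rows_eq_iff:
  assumes A: "A \<in> carrier_mat n1 m" and A': "A' \<in> carrier_mat n1 m"
    and B: "B \<in> carrier_mat n2 m" and B': "B' \<in> carrier_mat n2 m"
  shows "A @\<^sub>r B = A' @\<^sub>r B' \<longleftrightarrow> A = A' \<and> B = B'"
proof (intro iffI conjI)
  assume eq: "A @\<^sub>r B = A' @\<^sub>r B'"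
  show "A = A'"
  proof (rule eq_matI)
    fix r c assume "r < dim_row A'" "c < dim_col A'"
    then show "A $$ (r, c) = A' $$ (r, c)"
      using arg_cong[OF eq, of "\<lambda>M. M $$ (r, c)"] assms
      by (simp add: index_append_rows[of _ n1 m _ n2])
  qed (use A A' in auto)
  show "B = B'"
  proof (rule eq_matI)
    fix r c assume "r < dim_row B'" "c < dim_col B'"
    then show "B $$ (r, c) = B' $$ (r, c)"
      using arg_cong[OF eq, of "\<lambda>M. M $$ (n1 + r, c)"] assms
      by (simp add: index_append_rows[of _ n1 m _ n2])
  qed (use B B' in auto)
qed auto

lemma append_cols_carrier [simp, intro]:
  assumes "A \<in> carrier_mat n m1" and "B \<in> carrier_mat n m2"
  shows "A @\<^sub>c B \<in> carrier_mat n (m1 + m2)"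
  using assms by (intro carrier_matI) (simp_all add: append_cols_def)

lemma index_append_cols:
  assumes "A \<in> carrier_mat n m1" and "B \<in> carrier_mat n m2" and "r < n" and "c < m1 + m2"
  shows "(A @\<^sub>c B) $$ (r, c) = (if c < m1 then A $$ (r, c) else B $$ (r, c - m1))"
  using assms by (simp add: append_cols_def)

text \<open>Here the common cut is at column \<open>m1\<close>. The lemma serves to cancel equal
  zero columns on the right, which undoes the padding of a constraint.\<close>

lemma append_cols_eq_iff:
  assumes A: "A \<in> carrier_mat n m1" and A': "A' \<in> carrier_mat n m1"
    and B: "B \<in> carrier_mat n m2" and B': "B' \<in> carrier_mat n m2"
  shows "A @\<^sub>c B = A' @\<^sub>c B' \<longleftrightarrow> A = A' \<and> B = B'"
proof (intro iffI conjI)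
  assume eq: "A @\<^sub>c B = A' @\<^sub>c B'"
  show "A = A'"
  proof (rule eq_matI)
    fix r c assume "r < dim_row A'" "c < dim_col A'"
    then show "A $$ (r, c) = A' $$ (r, c)"
      using arg_cong[OF eq, of "\<lambda>M. M $$ (r, c)"] assms
      by (simp add: index_append_cols[of _ n m1 _ m2])
  qed (use A A' in auto)
  show "B = B'"
  proof (rule eq_matI)
    fix r c assume "r < dim_row B'" "c < dim_col B'"
    then show "B $$ (r, c) = B' $$ (r, c)"
      using arg_cong[OF eq, of "\<lambda>M. M $$ (r, m1 + c)"] assms
      by (simp add: index_append_cols[of _ n m1 _ m2])
  qed (use B B' in auto)
qed auto

section \<open>The infinity norm of a concatenated parameter\<close>

lemma linf_norm_le_iff:
  assumes "0 \<le> a"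
  shows "linf_norm v \<le> a \<longleftrightarrow> (\<forall>i<dim_vec v. \<bar>v $ i\<bar> \<le> a)"
  \<comment> \<open>The assumption \<open>0 \<le> a\<close> takes care of the 0 inserted into the
    set whose maximum is the norm.\<close>
  using assms by (auto simp: linf_norm_def)

text \<open>A bound on the infinity norm is a bound on each entry, and every entry of the
  concatenation comes from one of the two parts. Hence the norm condition on a joint parameter
  decouples.\<close>

lemma linf_norm_append_le_iff:
  assumes "0 \<le> a"
  shows "linf_norm (v @\<^sub>v w) \<le> a \<longleftrightarrow> linf_norm v \<le> a \<and> linf_norm w \<le> a"
proof -
  have "(\<forall>i<dim_vec (v @\<^sub>v w). \<bar>(v @\<^sub>v w) $ i\<bar> \<le> a) \<longleftrightarrow>
      (\<forall>i<dim_vec v. \<bar>v $ i\<bar> \<le> a) \<and> (\<forall>i<dim_vec w. \<bar>w $ i\<bar> \<le> a)" (is "?L \<longleftrightarrow> ?R")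
  proof (intro iffI conjI allI impI)
    fix i assume L: ?L and "i < dim_vec v"
    then show "\<bar>v $ i\<bar> \<le> a" using L[rule_format, of i] by simp
  next
    fix i assume L: ?L and "i < dim_vec w"
    then show "\<bar>w $ i\<bar> \<le> a" using L[rule_format, of "dim_vec v + i"] by simp
  next
    fix i assume ?R and "i < dim_vec (v @\<^sub>v w)"
    then show "\<bar>(v @\<^sub>v w) $ i\<bar> \<le> a" by simp
  qed
  then show ?thesis by (simp only: linf_norm_le_iff[OF assms])
qed

section \<open>Entries of linear combinations of blocks\<close>

lemma block_col_less: "c < m \<Longrightarrow> i < s \<Longrightarrow> i * m + c < m * s" for c m i s :: nat
  using mult_le_mono1[of "Suc i" s m] by (simp add: mult.commute)

lemma col_block_carrier: "M \<in> carrier_mat n N \<Longrightarrow> col_block m M i \<in> carrier_mat n m"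
  by (simp add: col_block_def)

lemma index_col_block:
  "M \<in> carrier_mat n N \<Longrightarrow> r < n \<Longrightarrow> c < m \<Longrightarrow> col_block m M i $$ (r, c) = M $$ (r, i * m + c)"
  by (simp add: col_block_def)

text \<open>Later proofs compare entries, so the sum in the module of matrices is turned into a sum
  of reals here. The width \<open>N\<close> is arbitrary, so that widths such as
  \<open>m * s + m * t\<close> fit as they stand.\<close>

lemma
  assumes "M \<in> carrier_mat n N"
  shows block_comb_carrier: "block_comb n m s M \<zeta> \<in> carrier_mat n m"
    and index_block_comb: "r < n \<Longrightarrow> c < m \<Longrightarrow>
      block_comb n m s M \<zeta> $$ (r, c) = (\<Sum>i<s. \<zeta> $ i * M $$ (r, i * m + c))"
proof -
  interpret abelian_group "module_mat TYPE(real) n m" by (rule abelian_group_mat)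
  have b: "\<zeta> $ i \<cdot>\<^sub>m col_block m M i \<in> carrier (module_mat TYPE(real) n m)" for i
    using col_block_carrier[OF assms] by (auto simp: module_mat_simps)
  \<comment> \<open>This is proved for every \<open>t\<close> because the induction below passes
    through all partial sums and needs their dimensions to read off entries.\<close>
  have closed: "block_comb n m t M \<zeta> \<in> carrier_mat n m" for t
    unfolding block_comb_def
    using finsum_closed[of "\<lambda>i. \<zeta> $ i \<cdot>\<^sub>m col_block m M i" "{..<t}"] b
    by (simp add: Pi_def module_mat_simps)
  then show "block_comb n m s M \<zeta> \<in> carrier_mat n m" .
  have comb_Suc: "block_comb n m (Suc t) M \<zeta>
      = \<zeta> $ t \<cdot>\<^sub>m col_block m M t + block_comb n m t M \<zeta>" for t
    unfolding block_comb_def lessThan_Suc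
    by (subst finsum_insert) (use b in \<open>simp_all add: Pi_def module_mat_simps\<close>)
  assume rc: "r < n" "c < m"
  show "block_comb n m s M \<zeta> $$ (r, c) = (\<Sum>i<s. \<zeta> $ i * M $$ (r, i * m + c))"
  proof (induction s)
    case 0
    show ?case using rc by (simp add: block_comb_def module_mat_simps)
  next
    case (Suc s)
    then show ?case using rc assms closed[of s] by (simp add: comb_Suc col_block_def)
  qed
qed

text \<open>The coefficients act on each row separately, so stacking rows commutes with taking the
  combination.\<close>

lemma block_comb_append_rows:
  assumes M: "M \<in> carrier_mat n1 (m * s)" and N: "N \<in> carrier_mat n2 (m * s)"
  shows "block_comb (n1 + n2) m s (M @\<^sub>r N) \<zeta>
    = block_comb n1 m s M \<zeta> @\<^sub>r block_comb n2 m s N \<zeta>"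
proof (rule eq_matI)
  have MN: "M @\<^sub>r N \<in> carrier_mat (n1 + n2) (m * s)" using M N by simp
  note bc = block_comb_carrier[OF M, of m s \<zeta>] block_comb_carrier[OF N, of m s \<zeta>]
  have R: "block_comb n1 m s M \<zeta> @\<^sub>r block_comb n2 m s N \<zeta> \<in> carrier_mat (n1 + n2) m"
    using bc by simp
  then show "dim_row (block_comb (n1 + n2) m s (M @\<^sub>r N) \<zeta>)
      = dim_row (block_comb n1 m s M \<zeta> @\<^sub>r block_comb n2 m s N \<zeta>)"
    and "dim_col (block_comb (n1 + n2) m s (M @\<^sub>r N) \<zeta>)
      = dim_col (block_comb n1 m s M \<zeta> @\<^sub>r block_comb n2 m s N \<zeta>)"
    using block_comb_carrier[OF MN, of m s \<zeta>] by auto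
  fix r c assume "r < dim_row (block_comb n1 m s M \<zeta> @\<^sub>r block_comb n2 m s N \<zeta>)"
    "c < dim_col (block_comb n1 m s M \<zeta> @\<^sub>r block_comb n2 m s N \<zeta>)"
  then have rc: "r < n1 + n2" "c < m" using R by auto
  then show "block_comb (n1 + n2) m s (M @\<^sub>r N) \<zeta> $$ (r, c)
      = (block_comb n1 m s M \<zeta> @\<^sub>r block_comb n2 m s N \<zeta>) $$ (r, c)"
    by (simp add: index_block_comb[OF MN] index_append_rows[OF bc] index_block_comb[OF M]
        index_block_comb[OF N] index_append_rows[OF M N] block_col_less)
qed

text \<open>The sum over \<open>s + t\<close> blocks is cut after block \<open>s\<close>. The first
  part meets only \<open>z\<close> and \<open>M\<close>, the second only \<open>w\<close> and
  \<open>N\<close>.\<close>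

lemma block_comb_append_cols:
  assumes M: "M \<in> carrier_mat n (m * s)" and N: "N \<in> carrier_mat n (m * t)"
    and z: "z \<in> carrier_vec s" and w: "w \<in> carrier_vec t"
  shows "block_comb n m (s + t) (M @\<^sub>c N) (z @\<^sub>v w) = block_comb n m s M z + block_comb n m t N w"
proof (rule eq_matI)
  have MN: "M @\<^sub>c N \<in> carrier_mat n (m * s + m * t)" using M N by simp
  note bc = block_comb_carrier[OF M, of m s z] block_comb_carrier[OF N, of m t w]
  show "dim_row (block_comb n m (s + t) (M @\<^sub>c N) (z @\<^sub>v w))
      = dim_row (block_comb n m s M z + block_comb n m t N w)"
    and "dim_col (block_comb n m (s + t) (M @\<^sub>c N) (z @\<^sub>v w))
      = dim_col (block_comb n m s M z + block_comb n m t N w)"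
    using block_comb_carrier[OF MN, of m "s + t" "z @\<^sub>v w"] bc by auto
  fix r c assume "r < dim_row (block_comb n m s M z + block_comb n m t N w)"
    "c < dim_col (block_comb n m s M z + block_comb n m t N w)"
  then have rc: "r < n" "c < m" using bc by auto
  have less: "i * m + c < m * s + m * t" if "i < s + t" for i
    using block_col_less[OF rc(2) that] by (simp add: distrib_left)
  have "block_comb n m (s + t) (M @\<^sub>c N) (z @\<^sub>v w) $$ (r, c)
      = (\<Sum>i<s + t. (z @\<^sub>v w) $ i * (M @\<^sub>c N) $$ (r, i * m + c))"
    by (rule index_block_comb[OF MN rc])
  also have "\<dots> = (\<Sum>i<s. (z @\<^sub>v w) $ i * (M @\<^sub>c N) $$ (r, i * m + c))
      + (\<Sum>i<t. (z @\<^sub>v w) $ (s + i) * (M @\<^sub>c N) $$ (r, (s + i) * m + c))"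
    \<comment> \<open>Induction on the number of blocks in the second part moves one summand at a
      time across the cut.\<close>
    by (induction t) (simp_all add: add.assoc)
  also have "(\<Sum>i<s. (z @\<^sub>v w) $ i * (M @\<^sub>c N) $$ (r, i * m + c))
      = (\<Sum>i<s. z $ i * M $$ (r, i * m + c))"
    using z w rc less by (intro sum.cong) (auto simp: index_append_cols[OF M N] block_col_less)
  also have "(\<Sum>i<t. (z @\<^sub>v w) $ (s + i) * (M @\<^sub>c N) $$ (r, (s + i) * m + c))
      = (\<Sum>i<t. w $ i * N $$ (r, i * m + c))"
  proof (intro sum.cong refl)
    fix i assume "i \<in> {..<t}"
    \<comment> \<open>Block \<open>s + i\<close> of the joined matrix is block \<open>i\<close> of
      \<open>N\<close>, because \<open>M\<close> occupies exactly the first \<open>m * s\<close>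
      columns.\<close>
    moreover have "(s + i) * m + c = m * s + (i * m + c)" by (simp add: algebra_simps)
    ultimately show "(z @\<^sub>v w) $ (s + i) * (M @\<^sub>c N) $$ (r, (s + i) * m + c)
        = w $ i * N $$ (r, i * m + c)"
      using z w rc block_col_less[of c m i t] by (simp add: index_append_cols[OF M N])
  qed
  finally show "block_comb n m (s + t) (M @\<^sub>c N) (z @\<^sub>v w) $$ (r, c)
      = (block_comb n m s M z + block_comb n m t N w) $$ (r, c)"
    using rc bc by (simp add: index_block_comb[OF M] index_block_comb[OF N])
qed

lemma block_comb_zero: "block_comb n m s (0\<^sub>m n (m * s)) \<zeta> = 0\<^sub>m n m"
proof (rule eq_matI)
  have Z: "0\<^sub>m n (m * s) \<in> carrier_mat n (m * s)" by simp
  show "dim_row (block_comb n m s (0\<^sub>m n (m * s)) \<zeta>) = dim_row (0\<^sub>m n m)"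
    and "dim_col (block_comb n m s (0\<^sub>m n (m * s)) \<zeta>) = dim_col (0\<^sub>m n m)"
    using block_comb_carrier[OF Z, of m s \<zeta>] by simp_all
  fix r c assume "r < dim_row (0\<^sub>m n m)" "c < dim_col (0\<^sub>m n m)"
  then show "block_comb n m s (0\<^sub>m n (m * s)) \<zeta> $$ (r, c) = 0\<^sub>m n m $$ (r, c)"
    by (simp add: index_block_comb[OF Z] block_col_less)
qed

lemma block_comb_uminus:
  assumes M: "M \<in> carrier_mat n (m * s)"
  shows "block_comb n m s (- M) \<zeta> = - block_comb n m s M \<zeta>"
proof -
  have M': "- M \<in> carrier_mat n (m * s)" using M by simp
  show ?thesis
    using block_comb_carrier[OF M, of m s \<zeta>] block_comb_carrier[OF M', of m s \<zeta>] M
    by (intro eq_matI)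
      (auto simp: index_block_comb[OF M] index_block_comb[OF M'] block_col_less sum_negf)
qed

section \<open>Padding blocks with zero columns\<close>

lemma row_of_blocks_carrier [simp]: "row_of_blocks n m s F \<in> carrier_mat n (m * s)"
  by (simp add: row_of_blocks_def)

lemma index_row_of_blocks:
  assumes "r < n" and "c < m" and "i < s"
  shows "row_of_blocks n m s F $$ (r, i * m + c) = F i $$ (r, c)"
  using assms block_col_less[of c m i s] by (simp add: row_of_blocks_def)

text \<open>Padding every block widens the stride from \<open>q\<close> to \<open>b\<close>, yet
  within each block the first \<open>q\<close> columns are those of \<open>M\<close> and the others
  vanish. Padding each generator thus amounts to padding the combination once.\<close>

lemma block_comb_pad:
  assumes M: "M \<in> carrier_mat n (q * s)" and b: "q \<le> b"
  shows "block_comb n b s (row_of_blocks n b s (\<lambda>i. col_block q M i @\<^sub>c 0\<^sub>m n (b - q))) \<zeta>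
    = block_comb n q s M \<zeta> @\<^sub>c 0\<^sub>m n (b - q)" (is "block_comb n b s ?P \<zeta> = ?Q")
proof (rule eq_matI)
  have P: "?P \<in> carrier_mat n (b * s)" by simp
  have Z: "0\<^sub>m n (b - q) \<in> carrier_mat n (b - q)" by simp
  note bc = block_comb_carrier[OF M, of q s \<zeta>]
  have Q: "?Q \<in> carrier_mat n b"
    using append_cols_carrier[OF bc Z] b by simp
  show "dim_row (block_comb n b s ?P \<zeta>) = dim_row ?Q"
    and "dim_col (block_comb n b s ?P \<zeta>) = dim_col ?Q"
    using Q block_comb_carrier[OF P, of b s \<zeta>] by auto
  fix r c assume "r < dim_row ?Q" "c < dim_col ?Q"
  then have rc: "r < n" "c < b" using Q by auto
  have "block_comb n b s ?P \<zeta> $$ (r, c)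
      = (\<Sum>i<s. \<zeta> $ i * (if c < q then M $$ (r, i * q + c) else 0))"
    unfolding index_block_comb[OF P rc]
    using rc b M
    by (intro sum.cong refl)
      (auto simp: index_row_of_blocks index_append_cols[OF col_block_carrier[OF M] Z] index_col_block[OF M])
  also have "\<dots> = ?Q $$ (r, c)"
    using rc b by (auto simp: index_append_cols[OF bc Z] index_block_comb[OF M])
  finally show "block_comb n b s ?P \<zeta> $$ (r, c) = ?Q $$ (r, c)" .
qed

section \<open>Differences of matrices\<close>

lemma minus_append_cols:
  assumes "A \<in> carrier_mat n m1" and "A' \<in> carrier_mat n m1"
    and "B \<in> carrier_mat n m2" and "B' \<in> carrier_mat n m2"
  shows "(A @\<^sub>c B) - (A' @\<^sub>c B') = (A - A') @\<^sub>c (B - B')"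
  using assms by (intro eq_matI) (auto simp: append_cols_def)

text \<open>The order of the summands is chosen so that the third block row becomes the equality of
  the points \<open>C1 + ?x z\<close> and \<open>C2 + ?y w\<close> of the two zonotopes.\<close>

lemma mat_diff_eq_diff_iff:
  fixes A B C D :: "'a :: ab_group_add mat"
  assumes "A \<in> carrier_mat n m" "B \<in> carrier_mat n m" "C \<in> carrier_mat n m" "D \<in> carrier_mat n m"
  shows "A - B = C - D \<longleftrightarrow> D + A = C + B"
proof -
  have "a - b = c - d \<longleftrightarrow> d + a = c + b" for a b c d :: 'a
    by (simp add: algebra_simps)
  with assms show ?thesis by (auto simp: mat_eq_iff)
qed

theorem lemma1:
  fixes n p s1 s2 k1 k2 q1 q2 b :: nat
    and G1 G2 C1 C2 A1 A2 B1 B2 :: "real mat"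
    and Gbar1 Gbar2 Cbar1 Cbar2 Abar1 Abar2 Bbar1 Bbar2 :: "real mat"
  assumes G1: "G1 \<in> carrier_mat n (p * s1)" and G2: "G2 \<in> carrier_mat n (p * s2)"
    and C1: "C1 \<in> carrier_mat n p" and C2: "C2 \<in> carrier_mat n p"
    and A1: "A1 \<in> carrier_mat k1 (q1 * s1)" and A2: "A2 \<in> carrier_mat k2 (q2 * s2)"
    and B1: "B1 \<in> carrier_mat k1 q1" and B2: "B2 \<in> carrier_mat k2 q2"
    and b: "b = max p (max q1 q2)"
    and Abar1: "Abar1 = row_of_blocks k1 b s1 (\<lambda>i. col_block q1 A1 i @\<^sub>c 0\<^sub>m k1 (b - q1))"
    and Abar2: "Abar2 = row_of_blocks k2 b s2 (\<lambda>i. col_block q2 A2 i @\<^sub>c 0\<^sub>m k2 (b - q2))"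
    and Bbar1: "Bbar1 = B1 @\<^sub>c 0\<^sub>m k1 (b - q1)"
    and Bbar2: "Bbar2 = B2 @\<^sub>c 0\<^sub>m k2 (b - q2)"
    and Gbar1: "Gbar1 = row_of_blocks n b s1 (\<lambda>i. col_block p G1 i @\<^sub>c 0\<^sub>m n (b - p))"
    and Gbar2: "Gbar2 = row_of_blocks n b s2 (\<lambda>i. col_block p G2 i @\<^sub>c 0\<^sub>m n (b - p))"
    and Cbar1: "Cbar1 = C1 @\<^sub>c 0\<^sub>m n (b - p)"
    and Cbar2: "Cbar2 = C2 @\<^sub>c 0\<^sub>m n (b - p)"
  shows "constrained_matrix_zonotope s1 G1 C1 A1 B1 \<inter> constrained_matrix_zonotope s2 G2 C2 A2 B2
    = constrained_matrix_zonotope (s1 + s2)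
        (G1 @\<^sub>c 0\<^sub>m n (p * s2))
        C1
        ((Abar1 @\<^sub>c 0\<^sub>m k1 (b * s2)) @\<^sub>r
         (0\<^sub>m k2 (b * s1) @\<^sub>c Abar2) @\<^sub>r
         (Gbar1 @\<^sub>c - Gbar2))
        (Bbar1 @\<^sub>r Bbar2 @\<^sub>r (Cbar2 - Cbar1))"
proof -
  have le: "p \<le> b" "q1 \<le> b" "q2 \<le> b" using b by auto
  let ?A = "(Abar1 @\<^sub>c 0\<^sub>m k1 (b * s2)) @\<^sub>r (0\<^sub>m k2 (b * s1) @\<^sub>c Abar2) @\<^sub>r (Gbar1 @\<^sub>c - Gbar2)"
  let ?B = "Bbar1 @\<^sub>r Bbar2 @\<^sub>r (Cbar2 - Cbar1)"
  have pad_carrier: "M @\<^sub>c 0\<^sub>m k (b - q) \<in> carrier_mat k b"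
    if "M \<in> carrier_mat k q" "q \<le> b" for M :: "real mat" and k q
    using append_cols_carrier[OF that(1), of "0\<^sub>m k (b - q)" "b - q"] that(2) by simp
  have Bbar1': "Bbar1 \<in> carrier_mat k1 b" and Bbar2': "Bbar2 \<in> carrier_mat k2 b"
    and Cbar1': "Cbar1 \<in> carrier_mat n b" and Cbar2': "Cbar2 \<in> carrier_mat n b"
    unfolding Bbar1 Bbar2 Cbar1 Cbar2 using B1 B2 C1 C2 le by (auto intro: pad_carrier)
  have Abar1': "Abar1 \<in> carrier_mat k1 (b * s1)" and Abar2': "Abar2 \<in> carrier_mat k2 (b * s2)"
    and Gbar1': "Gbar1 \<in> carrier_mat n (b * s1)" and Gbar2': "Gbar2 \<in> carrier_mat n (b * s2)"
    unfolding Abar1 Abar2 Gbar1 Gbar2 by simp_all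
  \<comment> \<open>The widths arise as \<open>b * s1 + b * s2\<close>. They are brought to the form
    \<open>b * (s1 + s2)\<close>, in which the block rows can be stacked and combined with
    \<open>s1 + s2\<close> generators.\<close>
  have rows: "Abar1 @\<^sub>c 0\<^sub>m k1 (b * s2) \<in> carrier_mat k1 (b * (s1 + s2))"
    "0\<^sub>m k2 (b * s1) @\<^sub>c Abar2 \<in> carrier_mat k2 (b * (s1 + s2))"
    "Gbar1 @\<^sub>c - Gbar2 \<in> carrier_mat n (b * (s1 + s2))"
    using append_cols_carrier[OF Abar1', of "0\<^sub>m k1 (b * s2)" "b * s2"]
      append_cols_carrier[OF _ Abar2', of "0\<^sub>m k2 (b * s1)" "b * s1"]
      append_cols_carrier[OF Gbar1', of "- Gbar2" "b * s2"] Gbar2'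
    by (simp_all add: distrib_left)
  \<comment> \<open>The zonotope takes the size of its constraint from \<open>?B\<close>. The
    nesting of the row count follows the right associativity of \<open>@\<^sub>r\<close>.\<close>
  have dims: "dim_row ?B = k1 + (k2 + n)" "dim_col ?B = b"
    using carrier_append_rows[OF Bbar1' carrier_append_rows[OF Bbar2' minus_carrier_mat[OF Cbar1']]]
    by auto
  let ?x = "block_comb n p s1 G1" and ?y = "block_comb n p s2 G2"
  \<comment> \<open>The last \<open>s2\<close> generators are zero, so the point depends on
    \<open>z\<close> alone and \<open>w\<close> enters only through the constraint.\<close>
  have generator: "block_comb n p (s1 + s2) (G1 @\<^sub>c 0\<^sub>m n (p * s2)) (z @\<^sub>v w) = ?x z"
    if "z \<in> carrier_vec s1" "w \<in> carrier_vec s2" for z w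
    using block_comb_append_cols[OF G1 zero_carrier_mat that] block_comb_carrier[OF G1, of p s1 z]
    by (simp add: block_comb_zero)
  \<comment> \<open>This is the core of the proof: the stacked constraint says that \<open>z\<close>
    and \<open>w\<close> are admissible for their own zonotopes and describe the same point.\<close>
  have constraint: "block_comb (k1 + (k2 + n)) b (s1 + s2) ?A (z @\<^sub>v w) = ?B \<longleftrightarrow>
      block_comb k1 q1 s1 A1 z = B1 \<and> block_comb k2 q2 s2 A2 w = B2 \<and> C1 + ?x z = C2 + ?y w"
    if z: "z \<in> carrier_vec s1" and w: "w \<in> carrier_vec s2" for z w
  proof -
    note x = block_comb_carrier[OF G1, of p s1 z] and y = block_comb_carrier[OF G2, of p s2 w]
    note a1 = block_comb_carrier[OF A1, of q1 s1 z] and a2 = block_comb_carrier[OF A2, of q2 s2 w]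
    let ?p1 = "block_comb k1 q1 s1 A1 z @\<^sub>c 0\<^sub>m k1 (b - q1)"
    let ?p2 = "block_comb k2 q2 s2 A2 w @\<^sub>c 0\<^sub>m k2 (b - q2)"
    let ?x' = "?x z @\<^sub>c 0\<^sub>m n (b - p)" and ?y' = "?y w @\<^sub>c 0\<^sub>m n (b - p)"
    note p1 = pad_carrier[OF a1 le(2)] and p2 = pad_carrier[OF a2 le(3)]
    note x' = pad_carrier[OF x le(1)] and y' = pad_carrier[OF y le(1)]
    \<comment> \<open>In the first two block rows the zero block removes the parameter of the other
      zonotope, which leaves a padded version of one original constraint.\<close>
    have r1: "block_comb k1 b (s1 + s2) (Abar1 @\<^sub>c 0\<^sub>m k1 (b * s2)) (z @\<^sub>v w) = ?p1"
      using block_comb_append_cols[OF Abar1' zero_carrier_mat z w] p1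
      unfolding Abar1 by (simp add: block_comb_zero block_comb_pad[OF A1 le(2)])
    have r2: "block_comb k2 b (s1 + s2) (0\<^sub>m k2 (b * s1) @\<^sub>c Abar2) (z @\<^sub>v w) = ?p2"
      using block_comb_append_cols[OF zero_carrier_mat Abar2' z w] p2
      unfolding Abar2 by (simp add: block_comb_zero block_comb_pad[OF A2 le(3)])
    \<comment> \<open>The sign in front of \<open>Gbar2\<close> makes the third block row the
      difference of the padded combinations of the generators.\<close>
    have r3: "block_comb n b (s1 + s2) (Gbar1 @\<^sub>c - Gbar2) (z @\<^sub>v w) = ?x' - ?y'"
      using block_comb_append_cols[OF Gbar1' uminus_carrier_mat[OF Gbar2'] z w]
        minus_add_uminus_mat[OF x' y']
      by (simp add: block_comb_uminus[OF Gbar2'])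
        (simp add: Gbar1 Gbar2 block_comb_pad[OF G1 le(1)] block_comb_pad[OF G2 le(1)])
    have "block_comb (k1 + (k2 + n)) b (s1 + s2) ?A (z @\<^sub>v w) = ?p1 @\<^sub>r ?p2 @\<^sub>r (?x' - ?y')"
      by (simp only: block_comb_append_rows[OF rows(1) carrier_append_rows[OF rows(2,3)]]
          block_comb_append_rows[OF rows(2,3)] r1 r2 r3)
    moreover have "?p1 @\<^sub>r ?p2 @\<^sub>r (?x' - ?y') = ?B \<longleftrightarrow>
        ?p1 = Bbar1 \<and> ?p2 = Bbar2 \<and> ?x' - ?y' = Cbar2 - Cbar1"
      by (simp only: append_rows_eq_iff[OF p1 Bbar1'
            carrier_append_rows[OF p2 minus_carrier_mat[OF y']]
            carrier_append_rows[OF Bbar2' minus_carrier_mat[OF Cbar1']]]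
          append_rows_eq_iff[OF p2 Bbar2' minus_carrier_mat[OF y'] minus_carrier_mat[OF Cbar1']])
    moreover have "?p1 = Bbar1 \<longleftrightarrow> block_comb k1 q1 s1 A1 z = B1"
      unfolding Bbar1 using append_cols_eq_iff[OF a1 B1 zero_carrier_mat zero_carrier_mat] by simp
    moreover have "?p2 = Bbar2 \<longleftrightarrow> block_comb k2 q2 s2 A2 w = B2"
      unfolding Bbar2 using append_cols_eq_iff[OF a2 B2 zero_carrier_mat zero_carrier_mat] by simp
    \<comment> \<open>On both sides the padding contributes a difference of zero matrices, so it
      cancels and the unpadded equation remains.\<close>
    moreover have "?x' - ?y' = Cbar2 - Cbar1 \<longleftrightarrow> ?x z - ?y w = C2 - C1"
      unfolding Cbar1 Cbar2
        minus_append_cols[OF x y zero_carrier_mat zero_carrier_mat]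
        minus_append_cols[OF C2 C1 zero_carrier_mat zero_carrier_mat]
      by (simp only: append_cols_eq_iff[OF minus_carrier_mat[OF y] minus_carrier_mat[OF C1]
            minus_carrier_mat[OF zero_carrier_mat] minus_carrier_mat[OF zero_carrier_mat]]) simp
    moreover have "?x z - ?y w = C2 - C1 \<longleftrightarrow> C1 + ?x z = C2 + ?y w"
      by (rule mat_diff_eq_diff_iff[OF x y C2 C1])
    ultimately show ?thesis by simp
  qed
  let ?Z1 = "constrained_matrix_zonotope s1 G1 C1 A1 B1"
  let ?Z2 = "constrained_matrix_zonotope s2 G2 C2 A2 B2"
  let ?Z = "constrained_matrix_zonotope (s1 + s2) (G1 @\<^sub>c 0\<^sub>m n (p * s2)) C1 ?A ?B"
  have Z1: "X \<in> ?Z1 \<longleftrightarrow> (\<exists>z. X = C1 + ?x z \<and> z \<in> carrier_vec s1 \<and> linf_norm z \<le> 1 \<and>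
      block_comb k1 q1 s1 A1 z = B1)" for X
    using C1 B1 by (auto simp: constrained_matrix_zonotope_def)
  have Z2: "X \<in> ?Z2 \<longleftrightarrow> (\<exists>w. X = C2 + ?y w \<and> w \<in> carrier_vec s2 \<and> linf_norm w \<le> 1 \<and>
      block_comb k2 q2 s2 A2 w = B2)" for X
    using C2 B2 by (auto simp: constrained_matrix_zonotope_def)
  \<comment> \<open>Every vector of dimension \<open>s1 + s2\<close> is a concatenation. The rule
    \<open>all_vec_append\<close> is universal, so it is applied to the negation of
    \<open>P\<close>.\<close>
  have split: "(\<exists>\<zeta> \<in> carrier_vec (s1 + s2). P \<zeta>) \<longleftrightarrow>
      (\<exists>z \<in> carrier_vec s1. \<exists>w \<in> carrier_vec s2. P (z @\<^sub>v w))" for P :: "real vec \<Rightarrow> bool"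
    using all_vec_append[of s1 s2 "\<lambda>\<zeta>. \<not> P \<zeta>"] by blast
  have "X \<in> ?Z \<longleftrightarrow> (\<exists>\<zeta> \<in> carrier_vec (s1 + s2).
      X = C1 + block_comb n p (s1 + s2) (G1 @\<^sub>c 0\<^sub>m n (p * s2)) \<zeta> \<and> linf_norm \<zeta> \<le> 1 \<and>
      block_comb (k1 + (k2 + n)) b (s1 + s2) ?A \<zeta> = ?B)" for X
    unfolding constrained_matrix_zonotope_def dims using C1 by auto
  then have Z: "X \<in> ?Z \<longleftrightarrow> (\<exists>z \<in> carrier_vec s1. \<exists>w \<in> carrier_vec s2.
      X = C1 + ?x z \<and> (linf_norm z \<le> 1 \<and> linf_norm w \<le> 1) \<and>
      block_comb k1 q1 s1 A1 z = B1 \<and> block_comb k2 q2 s2 A2 w = B2 \<and>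
      C1 + ?x z = C2 + ?y w)" for X
    unfolding split
    by (simp add: generator constraint linf_norm_append_le_iff cong: bex_cong)
  show ?thesis
    \<comment> \<open>A point of both zonotopes supplies \<open>z\<close> and \<open>w\<close> with
      equal images. Conversely, the equation \<open>C1 + ?x z = C2 + ?y w\<close> shows that a point
      given by \<open>z\<close> also lies in the second zonotope, with parameter
      \<open>w\<close>.\<close>
    by (rule Set.set_eqI) (unfold Int_iff Z Z1 Z2, blast)
qed

end
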